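(* Let weak pairs $(A,\omega_A)$ and $(B,\omega_B)$ be mirror symmetric. Suppose that the weak pair $(A,\omega_A)$ is in fact an algebraic pair. Then $(B,\omega_B)$ is an algebraic pair too.
   Context: A complex torus is $A=(V/\Gamma,J)$ with $\Gamma=\Gamma_A=H_1(A,\mathbb Z)$ a lattice of rank $2\dim A$, $V=V_A=\Gamma\otimes\mathbb R$, and $J=J_A\in\mathrm{End}(V)$, $J^2=-1$. The dual torus is $\hat A=(V^*/\Gamma^*,\hat J)$, $(\hat Jw)(v)=w(-Jv)$. The Néron–Severi group $NS_A$ is identified (by first Chern class) with the group of integral skew-symmetric forms $c$ on $\Gamma$ with $c_{\mathbb R}$ $J$-invariant, and with a subgroup of $\mathrm{Hom}(A,\hat A)$ via $c\mapsto(v\mapsto c(v,\cdot))$. $NS_A(\mathbb R)=NS_A\otimes\mathbb R$, $NS_A(\mathbb C)=NS_A\otimes\mathbb C$, $NS_A(\mathbb R)^0\subset NS_A(\mathbb R)$ is the set of nondegenerate forms, and $NS_A(\mathbb C)^0=\{\varphi_1+i\varphi_2\in NS_A(\mathbb C):\varphi_1\in NS_A(\mathbb R),\ \varphi_2\in NS_A(\mathbb R)^0\}$. $C_A^a\subset NS_A(\mathbb R)$ is the ample cone ($\mathbb R^+$-linear combinations of ample classes; equivalently the $c\in NS_A(\mathbb R)$ with $c(J\cdot,\cdot)$ positive definite), and $C_A=(NS_A(\mathbb R)+iC_A^a)\sqcup(NS_A(\mathbb R)-iC_A^a)\subset NS_A(\mathbb C)^0$; $C_A$ is nonempty iff $A$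 is an abelian variety. Put $\Lambda_A=\Gamma_A\oplus\Gamma_{\hat A}$ ($\Gamma_{\hat A}=\Gamma_A^*$) with $Q_A((a_1,b_1),(a_2,b_2))=b_1(a_2)+b_2(a_1)$; $J_{A\times\hat A}=(J,\hat J)$ acts on $V_A\oplus V_{\hat A}$. For $\omega=\varphi_1+i\varphi_2\in NS_A(\mathbb C)^0$ (with $\varphi_k:V_A\to V_{\hat A}$) put $$I_\omega=\begin{pmatrix}\varphi_2^{-1}\varphi_1&-\varphi_2^{-1}\\ \varphi_2+\varphi_1\varphi_2^{-1}\varphi_1&-\varphi_1\varphi_2^{-1}\end{pmatrix},$$ a complex structure on $V_A\oplus V_{\hat A}$. A weak pair $(A,\omega_A)$ is a complex torus $A$ with $\omega_A\in NS_A(\mathbb C)^0$; it is an algebraic pair if $A$ is an abelian variety and $\omega_A\in C_A$. Weak pairs $(A,\omega_A)$, $(B,\omega_B)$ are mirror symmetric if there is an isomorphism $\alpha:\Lambda_A\to\Lambda_B$ identifying $Q_A$ with $Q_B$ such that $\alpha_{\mathbb R}J_{A\times\hat A}=I_{\omega_B}\alpha_{\mathbb R}$ and $\alpha_{\mathbb R}I_{\omega_A}=J_{B\times\hat B}\alpha_{\mathbb R}$. *)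

theory Defs
  imports "HOL-Analysis.Analysis"
begin

section \<open>The dual of a real vector space\<close>

text \<open>The algebraic dual. Working over \<^class>\<open>real_vector\<close> (rather than with bounded functionals
  on a Euclidean space) keeps the ambient spaces free of auxiliary norms and also admits the
  zero space.\<close>

typedef (overloaded) 'a dual = "{f :: 'a::real_vector \<Rightarrow> real. linear f}"
  morphisms app Functional
  by (auto intro: linear_zero)

setup_lifting type_definition_dual

instantiation dual :: (real_vector) real_vector
begin

lift_definition zero_dual :: "'a dual" is "\<lambda>v. 0"
  by (rule linear_zero)

lift_definition plus_dual :: "'a dual \<Rightarrow> 'a dual \<Rightarrow> 'a dual" is "\<lambda>f g v. f v + g v"
  by (rule linear_compose_add)

lift_definition minus_dual :: "'a dual \<Rightarrow> 'a dual \<Rightarrow> 'a dual" is "\<lambda>f g v. f v - g v"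
  by (rule linear_compose_sub)

lift_definition uminus_dual :: "'a dual \<Rightarrow> 'a dual" is "\<lambda>f v. - f v"
  by (rule linear_compose_neg)

lift_definition scaleR_dual :: "real \<Rightarrow> 'a dual \<Rightarrow> 'a dual" is "\<lambda>r f v. r * f v"
  by (simp add: linear_iff algebra_simps)

instance
  by standard (transfer; simp add: fun_eq_iff algebra_simps)+

end


section \<open>Complex tori\<close>

text \<open>The torus \<open>(V/\<Gamma>, J)\<close> is given by the lattice \<open>\<Gamma> \<subseteq> V\<close> and the complex structure \<open>J\<close> on
  \<open>V = \<Gamma> \<otimes> \<real>\<close>; here \<open>V\<close> is the whole type \<^typ>\<open>'a\<close>. That the rank of \<open>\<Gamma>\<close> is even is
  forced by \<open>J\<^sup>2 = -1\<close>.\<close>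

record 'a torus =
  periods :: "'a set"
  cstruct :: "'a \<Rightarrow> 'a"

definition full_lattice :: "'a::real_vector set \<Rightarrow> bool" where
  "full_lattice \<Gamma> \<longleftrightarrow>
    (\<exists>B. finite B \<and> independent B \<and> span B = UNIV \<and>
         \<Gamma> = {\<Sum>b\<in>B. of_int (k b) *\<^sub>R b | k :: 'a \<Rightarrow> int. True})"

definition complex_torus :: "'a::real_vector torus \<Rightarrow> bool" where
  "complex_torus A \<longleftrightarrow>
    full_lattice (periods A) \<and> linear (cstruct A) \<and> (\<forall>v. cstruct A (cstruct A v) = - v)"

definition dual_torus :: "'a::real_vector torus \<Rightarrow> 'a dual torus" where
  "dual_torus A =
    \<lparr> periods = {f. \<forall>v\<in>periods A. app f v \<in> \<int>},
      cstruct = (\<lambda>f. Functional (\<lambda>v. app f (- cstruct A v))) \<rparr>"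


section \<open>N\'eron--Severi groups and the ample cone\<close>

text \<open>An integral form \<open>c\<close> on \<open>\<Gamma>\<close> is represented by its real bilinear extension to \<open>V\<close>. As \<open>\<Gamma>\<close> is
  a full lattice, the tensor products of the N\'eron--Severi group with \<open>\<real>\<close> and \<open>\<complex>\<close> embed into
  the real and complex valued real-bilinear forms on \<open>V\<close>.\<close>

type_synonym 'a form = "'a \<Rightarrow> 'a \<Rightarrow> real"

definition NS :: "'a::real_vector torus \<Rightarrow> 'a form set" where
  "NS A = {c. bilinear c \<and> (\<forall>v w. c v w = - c w v) \<and>
              (\<forall>v\<in>periods A. \<forall>w\<in>periods A. c v w \<in> \<int>) \<and>
              (\<forall>v w. c (cstruct A v) (cstruct A w) = c v w)}"

definition NS_real :: "'a::real_vector torus \<Rightarrow> 'a form set" where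
  "NS_real A = {\<lambda>v w. \<Sum>i<n. r i * c i v w | (n :: nat) (r :: nat \<Rightarrow> real) c. \<forall>i<n. c i \<in> NS A}"

definition nondegenerate :: "'a::real_vector form \<Rightarrow> bool" where
  "nondegenerate \<phi> \<longleftrightarrow> (\<forall>v. (\<forall>w. \<phi> v w = 0) \<longrightarrow> v = 0)"

definition NS_real0 :: "'a::real_vector torus \<Rightarrow> 'a form set" where
  "NS_real0 A = {\<phi> \<in> NS_real A. nondegenerate \<phi>}"

definition complex_form :: "'a form \<Rightarrow> 'a form \<Rightarrow> 'a \<Rightarrow> 'a \<Rightarrow> complex" where
  "complex_form \<phi>\<^sub>1 \<phi>\<^sub>2 = (\<lambda>v w. complex_of_real (\<phi>\<^sub>1 v w) + \<i> * complex_of_real (\<phi>\<^sub>2 v w))"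

definition re_form :: "('a \<Rightarrow> 'a \<Rightarrow> complex) \<Rightarrow> 'a form" where
  "re_form \<omega> = (\<lambda>v w. Re (\<omega> v w))"

definition im_form :: "('a \<Rightarrow> 'a \<Rightarrow> complex) \<Rightarrow> 'a form" where
  "im_form \<omega> = (\<lambda>v w. Im (\<omega> v w))"

definition NS_complex0 :: "'a::real_vector torus \<Rightarrow> ('a \<Rightarrow> 'a \<Rightarrow> complex) set" where
  "NS_complex0 A = {complex_form \<phi>\<^sub>1 \<phi>\<^sub>2 | \<phi>\<^sub>1 \<phi>\<^sub>2. \<phi>\<^sub>1 \<in> NS_real A \<and> \<phi>\<^sub>2 \<in> NS_real0 A}"

text \<open>A line bundle on a complex torus is ample iff its first Chern class \<open>c\<close> makes \<open>c(J\<cdot>,\<cdot>)\<close>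
  positive definite, and a complex torus is an abelian variety iff it carries an ample line
  bundle (Lefschetz).\<close>

definition ample_classes :: "'a::real_vector torus \<Rightarrow> 'a form set" where
  "ample_classes A = {c \<in> NS A. \<forall>v. v \<noteq> 0 \<longrightarrow> c (cstruct A v) v > 0}"

definition abelian_variety :: "'a::real_vector torus \<Rightarrow> bool" where
  "abelian_variety A \<longleftrightarrow> complex_torus A \<and> ample_classes A \<noteq> {}"

text \<open>Nonempty combinations with strictly positive coefficients: the zero class belongs to the
  ample cone only for the zero-dimensional torus.\<close>

definition ample_cone :: "'a::real_vector torus \<Rightarrow> 'a form set" where
  "ample_cone A =
    {\<lambda>v w. \<Sum>i<n. r i * c i v w | (n :: nat) (r :: nat \<Rightarrow> real) c.
       n > 0 \<and> (\<forall>i<n. r i > 0 \<and> c i \<in> ample_classes A)}"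

definition complexified_cone :: "'a::real_vector torus \<Rightarrow> ('a \<Rightarrow> 'a \<Rightarrow> complex) set" where
  "complexified_cone A =
    {complex_form \<phi>\<^sub>1 \<phi>\<^sub>2 | \<phi>\<^sub>1 \<phi>\<^sub>2. \<phi>\<^sub>1 \<in> NS_real A \<and> \<phi>\<^sub>2 \<in> ample_cone A} \<union>
    {complex_form \<phi>\<^sub>1 (\<lambda>v w. - \<phi>\<^sub>2 v w) | \<phi>\<^sub>1 \<phi>\<^sub>2. \<phi>\<^sub>1 \<in> NS_real A \<and> \<phi>\<^sub>2 \<in> ample_cone A}"


section \<open>Pairs and mirror symmetry\<close>

definition weak_pair :: "'a::real_vector torus \<Rightarrow> ('a \<Rightarrow> 'a \<Rightarrow> complex) \<Rightarrow> bool" where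
  "weak_pair A \<omega> \<longleftrightarrow> complex_torus A \<and> \<omega> \<in> NS_complex0 A"

definition algebraic_pair :: "'a::real_vector torus \<Rightarrow> ('a \<Rightarrow> 'a \<Rightarrow> complex) \<Rightarrow> bool" where
  "algebraic_pair A \<omega> \<longleftrightarrow> weak_pair A \<omega> \<and> abelian_variety A \<and> \<omega> \<in> complexified_cone A"

definition Lambda :: "'a::real_vector torus \<Rightarrow> ('a \<times> 'a dual) set" where
  "Lambda A = periods A \<times> periods (dual_torus A)"

definition Q :: "'a::real_vector \<times> 'a dual \<Rightarrow> 'a \<times> 'a dual \<Rightarrow> real" where
  "Q x y = app (snd x) (fst y) + app (snd y) (fst x)"

definition J_prod :: "'a::real_vector torus \<Rightarrow> 'a \<times> 'a dual \<Rightarrow> 'a \<times> 'a dual" where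
  "J_prod A = map_prod (cstruct A) (cstruct (dual_torus A))"

definition form_map :: "'a::real_vector form \<Rightarrow> 'a \<Rightarrow> 'a dual" where
  "form_map \<phi> v = Functional (\<phi> v)"

text \<open>For a nondegenerate bilinear form on a finite-dimensional space, \<^const>\<open>form_map\<close> is
  bijective, so \<^const>\<open>inv\<close> below is a genuine inverse.\<close>

definition I_op :: "('a::real_vector \<Rightarrow> 'a \<Rightarrow> complex) \<Rightarrow> 'a \<times> 'a dual \<Rightarrow> 'a \<times> 'a dual" where
  "I_op \<omega> = (let f1 = form_map (re_form \<omega>); f2 = form_map (im_form \<omega>); g = inv f2
     in (\<lambda>(v, l). (g (f1 v) - g l, f2 v + f1 (g (f1 v)) - f1 (g l))))"

text \<open>An isomorphism of lattices \<open>\<Lambda>\<^sub>A \<rightarrow> \<Lambda>\<^sub>B\<close> is represented by its real-linear extension \<open>\<alpha>\<close>, which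
  is unique because \<open>\<Lambda>\<^sub>A\<close> spans.\<close>

definition mirror_symmetric ::
    "'a::real_vector torus \<Rightarrow> ('a \<Rightarrow> 'a \<Rightarrow> complex) \<Rightarrow>
     'b::real_vector torus \<Rightarrow> ('b \<Rightarrow> 'b \<Rightarrow> complex) \<Rightarrow> bool" where
  "mirror_symmetric A \<omega>A B \<omega>B \<longleftrightarrow>
    (\<exists>\<alpha> :: 'a \<times> 'a dual \<Rightarrow> 'b \<times> 'b dual.
       linear \<alpha> \<and> bij_betw \<alpha> (Lambda A) (Lambda B) \<and>
       (\<forall>x\<in>Lambda A. \<forall>y\<in>Lambda A. Q (\<alpha> x) (\<alpha> y) = Q x y) \<and>
       \<alpha> \<circ> J_prod A = I_op \<omega>B \<circ> \<alpha> \<and>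
       \<alpha> \<circ> I_op \<omega>A = J_prod B \<circ> \<alpha>)"

end

theory Submission imports Defs
begin

text \<open>Write \<open>\<omega> = \<phi>\<^sub>1 + i\<phi>\<^sub>2\<close>. Being an algebraic pair is a property of the triple
  \<open>(Q, J, I)\<close> on \<open>V \<oplus> V\<^sup>*\<close>, where \<open>J\<close> is the product complex structure and \<open>I = I\<^sub>\<omega>\<close>: it says that
  the symmetric form \<open>x, y \<mapsto> Q(I J x, y)\<close> is definite, positive or negative. This criterion is
  lemma \<open>algebraic_pair_iff\<close>. A mirror isomorphism is a \<open>Q\<close>-isometry that carries the pair
  \<open>(J, I)\<close> of \<open>A\<close> to the pair \<open>(I, J)\<close> of \<open>B\<close>. Since \<open>I\<close> and \<open>J\<close> commute, it carries \<open>I J\<close> to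
  \<open>I J\<close>, so definiteness passes from \<open>A\<close> to \<open>B\<close>.

  The criterion has two ingredients. The first is linear algebra: the coordinates
  \<open>(v, u) \<mapsto> (v, \<phi>\<^sub>1 v - \<phi>\<^sub>2 u)\<close> on \<open>V \<oplus> V\<^sup>*\<close> turn \<open>I\<close> into the rotation \<open>(v, u) \<mapsto> (u, -v)\<close>, turn \<open>J\<close>
  into \<open>(v, u) \<mapsto> (J v, J u)\<close>, and remove \<open>\<phi>\<^sub>1\<close> from \<open>Q\<close>. In them the quadratic form \<open>Q(I J x, x)\<close> is
  \<open>\<phi>\<^sub>2(J v, v) + \<phi>\<^sub>2(J u, u)\<close>, which is definite iff \<open>\<phi>\<^sub>2(J\<cdot>, \<cdot>)\<close> is (lemma \<open>Q_IJ_chart\<close>).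

  The second is the description of the ample cone by positivity
  (lemma \<open>positive_definite_in_ample_cone\<close>): a real class \<open>\<phi>\<close> with \<open>\<phi>(J\<cdot>, \<cdot>)\<close> positive definite is
  a positive combination of integral ones. Positive definiteness is an open condition,
  so a large multiple of \<open>\<phi>\<close> can be rounded to an integral class without leaving it, and the
  rounding error can be absorbed into ample classes. In particular \<open>B\<close>, which is only given as a
  complex torus, acquires an ample class.\<close>

section \<open>Duals and lattices\<close>

lemma app_arith [simp]:
  "app 0 v = 0" "app (f + g) v = app f v + app g v" "app (f - g) v = app f v - app g v"
  "app (- f) v = - app f v" "app (r *\<^sub>R f) v = r * app f v"
  by (simp_all add: zero_dual.rep_eq plus_dual.rep_eq minus_dual.rep_eq uminus_dual.rep_eq
      scaleR_dual.rep_eq)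

lemma linear_app: "linear (app f)"
  using app by auto

lemma app_sum: "app (sum f S) v = (\<Sum>i\<in>S. app (f i) v)"
  by (induction S rule: infinite_finite_induct) auto

lemma dual_eqI: "(\<And>v. app f v = app g v) \<Longrightarrow> f = g"
  by (metis app_inject ext)

lemma app_form_map [simp]: "bilinear \<phi> \<Longrightarrow> app (form_map \<phi> v) w = \<phi> v w"
  by (simp add: form_map_def Functional_inverse bilinear_def)

lemma linear_form_map:
  assumes "bilinear \<phi>"
  shows "linear (form_map \<phi>)"
  by (rule linearI; rule dual_eqI)
     (simp_all add: assms bilinear_ladd bilinear_lmul)

lemma app_cstruct_dual_torus:
  assumes "linear (cstruct A)"
  shows "app (cstruct (dual_torus A) f) v = app f (- cstruct A v)"
proof -
  have "linear (\<lambda>v. app f (- cstruct A v))"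
    using linear_compose[OF linear_compose_neg[OF assms] linear_app[of f]] by (simp add: o_def)
  then show ?thesis
    by (simp add: dual_torus_def Functional_inverse)
qed

lemma full_lattice_span: "full_lattice \<Gamma> \<Longrightarrow> span \<Gamma> = UNIV"
proof -
  assume "full_lattice \<Gamma>"
  then obtain B where B: "finite B" "span B = UNIV"
    and \<Gamma>: "\<Gamma> = {\<Sum>b\<in>B. of_int (k b) *\<^sub>R b | k :: 'a \<Rightarrow> int. True}"
    unfolding full_lattice_def by blast
  have "b \<in> \<Gamma>" if "b \<in> B" for b
  proof -
    have "(\<Sum>c\<in>B. of_int (if c = b then 1 else 0) *\<^sub>R c) = (\<Sum>c\<in>B. if c = b then b else 0)"
      by (rule sum.cong) auto
    then have "b = (\<Sum>c\<in>B. of_int (if c = b then 1 else 0) *\<^sub>R c)"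
      using B(1) that by simp
    then show ?thesis
      unfolding \<Gamma> by fast
  qed
  then have "span B \<subseteq> span \<Gamma>"
    by (meson span_mono subsetI)
  with B show ?thesis by blast
qed

lemma finite_basis_of_complex_torus:
  fixes A :: "'a::real_vector torus"
  assumes "complex_torus A"
  obtains B :: "'a set" where "finite B" "independent B" "span B = UNIV"
  using assms unfolding complex_torus_def full_lattice_def by blast

lemma linear_expansion:
  fixes f :: "'a::real_vector \<Rightarrow> 'b::real_vector" and B :: "'a set"
  assumes "finite B" "independent B" "span B = UNIV" "linear f"
  shows "f v = (\<Sum>b\<in>B. representation B v b *\<^sub>R f b)"
proof -
  have "f v = f (\<Sum>b\<in>B. representation B v b *\<^sub>R b)"
    using assms by (simp add: real_vector.sum_representation_eq)
  then show ?thesis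
    using assms(4) by (simp add: linear_sum linear_scale)
qed

lemma linear_representation:
  assumes "independent B" "span B = UNIV"
  shows "linear (\<lambda>v. representation B v b)"
  by (rule linearI)
     (simp_all add: assms real_vector.representation_add real_vector.representation_scale)

text \<open>The dual basis of a lattice basis consists of functionals that are integral on the lattice, so
  the dual lattice spans \<open>V\<^sup>*\<close>. Consequently a linear or bilinear identity on \<open>V \<oplus> V\<^sup>*\<close> can be checked
  on lattice vectors.\<close>

lemma span_Lambda:
  assumes "complex_torus A"
  shows "span (Lambda A) = UNIV"
proof -
  from assms have fl: "full_lattice (periods A)"
    by (simp add: complex_torus_def)
  then obtain B where B: "finite B" "independent B" "span B = UNIV"
    and \<Gamma>: "periods A = {\<Sum>b\<in>B. of_int (k b) *\<^sub>R b | k :: 'a \<Rightarrow> int. True}"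
    unfolding full_lattice_def by blast
  define \<Gamma>' where "\<Gamma>' = periods (dual_torus A)"
  define d where "d b = Functional (\<lambda>v. representation B v b)" for b
  have app_d: "app (d b) v = representation B v b" for b v
    unfolding d_def using linear_representation[OF B(2,3)] by (simp add: Functional_inverse)
  have zero: "0 \<in> periods A" "0 \<in> \<Gamma>'"
    using \<Gamma> by (auto simp: \<Gamma>'_def dual_torus_def intro!: exI[of _ "\<lambda>_. 0"])
  have d_int: "d b \<in> \<Gamma>'" if "b \<in> B" for b
  proof -
    have "representation B (\<Sum>c\<in>B. of_int (k c) *\<^sub>R c) b = of_int (k b)" for k
    proof -
      have "representation B (\<Sum>c\<in>B. of_int (k c) *\<^sub>R c) b
          = (\<Sum>c\<in>B. of_int (k c) *\<^sub>R representation B c b)"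
        by (simp add: linear_sum[OF linear_representation[OF B(2,3), of b]]
            linear_scale[OF linear_representation[OF B(2,3), of b]])
      also have "\<dots> = (\<Sum>c\<in>B. if c = b then of_int (k b) else 0)"
        by (rule sum.cong) (auto simp: real_vector.representation_basis[OF B(2)])
      finally show ?thesis using B(1) that by simp
    qed
    then show ?thesis
      unfolding \<Gamma>'_def dual_torus_def \<Gamma> by (auto simp: app_d)
  qed
  have "(v, l) \<in> span (Lambda A)" for v l
  proof -
    have "(v, 0 :: 'a dual) \<in> (\<lambda>x. (x, 0)) ` span (periods A)"
      using full_lattice_span[OF fl] by auto
    also have "\<dots> = span ((\<lambda>x. (x, 0)) ` periods A)"
      by (rule linear_span_image[symmetric]) (rule linearI; simp)
    also have "\<dots> \<subseteq> span (Lambda A)"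
      using zero by (intro span_mono) (auto simp: Lambda_def \<Gamma>'_def)
    finally have v: "(v, 0) \<in> span (Lambda A)" .
    have l: "(0, l) = (\<Sum>b\<in>B. app l b *\<^sub>R (0 :: 'a, d b))"
    proof -
      have "l = (\<Sum>b\<in>B. app l b *\<^sub>R d b)"
      proof (rule dual_eqI)
        fix v show "app l v = app (\<Sum>b\<in>B. app l b *\<^sub>R d b) v"
          using linear_expansion[OF B linear_app, of l v]
          by (simp add: app_sum app_d mult.commute)
      qed
      moreover have "(\<Sum>b\<in>B. app l b *\<^sub>R (0 :: 'a, d b)) = (0, \<Sum>b\<in>B. app l b *\<^sub>R d b)"
        by (simp add: prod_eq_iff fst_sum snd_sum)
      ultimately show ?thesis by simp
    qed
    have "(0, l) \<in> span (Lambda A)"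
      unfolding l using zero d_int
      by (intro span_sum span_scale span_base) (auto simp: Lambda_def \<Gamma>'_def)
    from span_add[OF v this] show ?thesis by simp
  qed
  then show ?thesis by auto
qed

text \<open>Evaluation on a basis identifies \<open>V\<^sup>*\<close> with \<open>V\<close> itself, and \<^const>\<open>form_map\<close> with an injective
  endomorphism \<open>L\<close> of \<open>V\<close>, which is surjective for reasons of dimension. This is what makes the
  inverse in \<^const>\<open>I_op\<close> meaningful, and it also serves as the Riesz representation theorem.\<close>

lemma bij_form_map:
  fixes \<phi> :: "'a::real_vector form" and B :: "'a set"
  assumes B: "finite B" "independent B" "span B = UNIV"
    and \<phi>: "bilinear \<phi>" "nondegenerate \<phi>"
  shows "bij (form_map \<phi>)"
proof (rule bijI)
  interpret fd: finite_dimensional_vector_space scaleR B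
    using B by unfold_locales (auto simp: dependent_raw_def span_raw_def)
  have inj: "v = 0" if "\<And>b. b \<in> B \<Longrightarrow> \<phi> v b = 0" for v
  proof -
    have "\<phi> v w = 0" for w
      using linear_expansion[OF B, of "\<phi> v" w] \<phi>(1) that by (simp add: bilinear_def)
    then show ?thesis
      using \<phi>(2) by (simp add: nondegenerate_def)
  qed
  show "inj (form_map \<phi>)"
    unfolding linear_injective_0[OF linear_form_map[OF \<phi>(1)]]
  proof (intro allI impI)
    fix v assume "form_map \<phi> v = 0"
    then have "\<phi> v b = 0" for b
      using app_form_map[OF \<phi>(1), of v b] by simp
    then show "v = 0" by (rule inj)
  qed
  define L where "L v = (\<Sum>b\<in>B. \<phi> v b *\<^sub>R b)" for v
  have L: "linear L"
    by (rule linearI)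
       (simp_all add: L_def bilinear_ladd[OF \<phi>(1)] bilinear_lmul[OF \<phi>(1)] algebra_simps
         sum.distrib scaleR_sum_right)
  have coord: "f b = g b" if eq: "(\<Sum>b\<in>B. f b *\<^sub>R b) = (\<Sum>b\<in>B. g b *\<^sub>R b)" and "b \<in> B"
    for f g :: "'a \<Rightarrow> real" and b
  proof -
    have "(\<Sum>b\<in>B. (f b - g b) *\<^sub>R b) = 0"
      using eq by (simp add: scaleR_left_diff_distrib sum_subtractf)
    with independentD[OF B(2,1) order_refl this \<open>b \<in> B\<close>] show ?thesis by simp
  qed
  have "inj L"
    unfolding linear_injective_0[OF L]
  proof (intro allI impI)
    fix v assume "L v = 0"
    then have "(\<Sum>b\<in>B. \<phi> v b *\<^sub>R b) = (\<Sum>b\<in>B. 0 *\<^sub>R b)" by (simp add: L_def)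
    from coord[OF this] show "v = 0" by (rule inj)
  qed
  then have "surj L"
    using L by (intro fd.linear_inj_imp_surj) (auto simp: linear_def)
  show "surj (form_map \<phi>)"
  proof (rule surjI)
    fix l
    define v where "v = inv L (\<Sum>b\<in>B. app l b *\<^sub>R b)"
    have "L v = (\<Sum>b\<in>B. app l b *\<^sub>R b)"
      unfolding v_def using \<open>surj L\<close> by (simp add: surj_f_inv_f)
    then have "\<phi> v b = app l b" if "b \<in> B" for b
      using that unfolding L_def by (rule coord)
    then have "\<phi> v w = app l w" for w
      using linear_expansion[OF B, of "\<phi> v" w] linear_expansion[OF B linear_app, of l w] \<phi>(1)
      by (simp add: bilinear_def)
    then show "form_map \<phi> (inv L (\<Sum>b\<in>B. app l b *\<^sub>R b)) = l"
      using \<phi>(1) unfolding v_def[symmetric] by (intro dual_eqI) simp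
  qed
qed

section \<open>Positive definite forms dominate all quadratic forms\<close>

text \<open>Openness of positive definiteness is obtained here without a norm on \<open>V\<close>: the scale is set by the
  positive definite form \<open>g\<close> itself. Every functional is \<open>g(u, \<cdot>)\<close> for some \<open>u\<close>, hence is bounded with
  respect to \<open>g\<close> by Cauchy--Schwarz, and every quadratic form is a sum of products of functionals.\<close>

definition positive_definite :: "'a::real_vector form \<Rightarrow> bool" where
  "positive_definite g \<longleftrightarrow> (\<forall>v. v \<noteq> 0 \<longrightarrow> 0 < g v v)"

lemma positive_definite_nonneg:
  assumes "positive_definite g" "bilinear g"
  shows "0 \<le> g v v"
  using assms by (cases "v = 0") (auto simp: positive_definite_def bilinear_lzero less_imp_le)

lemma form_Cauchy_Schwarz:
  assumes g: "bilinear g" "\<And>v w. g v w = g w v" "positive_definite g"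
  shows "(g x y)\<^sup>2 \<le> g x x * g y y"
proof (cases "y = 0")
  case True
  then show ?thesis using g(1) by (simp add: bilinear_rzero)
next
  case False
  then have pos: "0 < g y y" using g(3) by (simp add: positive_definite_def)
  \<comment> \<open>the component of \<open>x\<close> orthogonal to \<open>y\<close>, with denominators cleared\<close>
  define z where "z = g y y *\<^sub>R x - g x y *\<^sub>R y"
  have "0 \<le> g z z"
    by (rule positive_definite_nonneg[OF g(3,1)])
  also have "g z z = g y y * (g x x * g y y - (g x y)\<^sup>2)"
    unfolding z_def
    by (simp add: bilinear_lsub[OF g(1)] bilinear_rsub[OF g(1)] bilinear_lmul[OF g(1)]
        bilinear_rmul[OF g(1)] g(2)[of y x] algebra_simps power2_eq_square)
  finally show ?thesis
    using pos by (simp add: zero_le_mult_iff)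
qed

lemma functional_dominated:
  fixes g :: "'a::real_vector form" and B :: "'a set" and f :: "'a \<Rightarrow> real"
  assumes B: "finite B" "independent B" "span B = UNIV"
    and g: "bilinear g" "\<And>v w. g v w = g w v" "positive_definite g"
    and "linear f"
  obtains K where "K \<ge> 0" "\<And>v. (f v)\<^sup>2 \<le> K * g v v"
proof -
  have "nondegenerate g"
    using g(3) unfolding positive_definite_def nondegenerate_def by (metis less_irrefl)
  then have "surj (form_map g)"
    using bij_form_map[OF B g(1)] by (simp add: bij_is_surj)
  then obtain u where u: "Functional f = form_map g u"
    by (meson surjD)
  have "f v = g u v" for v
    using arg_cong[OF u, of "\<lambda>l. app l v"] \<open>linear f\<close> g(1) by (simp add: Functional_inverse)
  then have "(f v)\<^sup>2 \<le> g u u * g v v" for v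
    using form_Cauchy_Schwarz[OF g] by simp
  then show ?thesis
    using positive_definite_nonneg[OF g(3,1)] that by blast
qed

lemma quadratic_form_dominated:
  fixes g c :: "'a::real_vector form" and B :: "'a set"
  assumes B: "finite B" "independent B" "span B = UNIV"
    and g: "bilinear g" "\<And>v w. g v w = g w v" "positive_definite g"
    and c: "bilinear c"
  obtains K where "K \<ge> 0" "\<And>v. \<bar>c v v\<bar> \<le> K * g v v"
proof -
  \<comment> \<open>expanding the first argument only, each summand is a product of two functionals\<close>
  let ?r = "\<lambda>v b. representation B v b"
  have "\<exists>K\<ge>0. \<forall>v. \<bar>?r v b * c b v\<bar> \<le> K * g v v" for b
  proof -
    have "linear (c b)" using c by (simp add: bilinear_def)
    obtain K1 where K1: "K1 \<ge> 0" "\<And>v. (?r v b)\<^sup>2 \<le> K1 * g v v"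
      using functional_dominated[OF B g linear_representation[OF B(2,3), of b]] by blast
    obtain K2 where K2: "K2 \<ge> 0" "\<And>v. (c b v)\<^sup>2 \<le> K2 * g v v"
      using functional_dominated[OF B g \<open>linear (c b)\<close>] by blast
    have "\<bar>?r v b * c b v\<bar> \<le> (K1 + K2) * g v v" for v
    proof -
      have "2 * (\<bar>?r v b\<bar> * \<bar>c b v\<bar>) \<le> (?r v b)\<^sup>2 + (c b v)\<^sup>2"
        using sum_squares_bound[of "\<bar>?r v b\<bar>" "\<bar>c b v\<bar>"] by (simp add: algebra_simps)
      then have "\<bar>?r v b * c b v\<bar> \<le> (?r v b)\<^sup>2 + (c b v)\<^sup>2"
        using mult_nonneg_nonneg[of "\<bar>?r v b\<bar>" "\<bar>c b v\<bar>"] unfolding abs_mult by linarith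
      with K1(2)[of v] K2(2)[of v] show ?thesis
        by (simp add: algebra_simps)
    qed
    with K1(1) K2(1) show ?thesis
      by (intro exI[of _ "K1 + K2"]) auto
  qed
  then obtain K where K: "\<And>b. K b \<ge> 0" "\<And>b v. \<bar>?r v b * c b v\<bar> \<le> K b * g v v"
    by metis
  have "\<bar>c v v\<bar> \<le> sum K B * g v v" for v
  proof -
    have "c v v = (\<Sum>b\<in>B. ?r v b * c b v)"
      using linear_expansion[OF B, of "\<lambda>x. c x v" v] c by (simp add: bilinear_def)
    also have "\<bar>\<dots>\<bar> \<le> (\<Sum>b\<in>B. K b * g v v)"
      by (rule order_trans[OF sum_abs]) (intro sum_mono K)
    finally show ?thesis by (simp add: sum_distrib_right)
  qed
  then show ?thesis
    using that[of "sum K B"] K(1) by (simp add: sum_nonneg)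
qed

section \<open>The ample cone\<close>

text \<open>The form \<open>\<phi>(J\<cdot>, \<cdot>)\<close>, whose positivity defines ampleness. It is symmetric because \<open>\<phi>\<close> is skew and
  \<open>J\<close>-invariant.\<close>

definition symmetric_form :: "'a::real_vector torus \<Rightarrow> 'a form \<Rightarrow> 'a form" where
  "symmetric_form A \<phi> v w = \<phi> (cstruct A v) w"

lemma bilinear_sum_combination:
  assumes "\<And>i. i \<in> S \<Longrightarrow> bilinear (c i)"
  shows "bilinear (\<lambda>v w. \<Sum>i\<in>S. r i * c i v w :: real)"
  unfolding bilinear_def
  by (intro conjI allI linearI)
     (use assms in \<open>simp_all add: bilinear_ladd bilinear_radd bilinear_lmul bilinear_rmul
        algebra_simps sum.distrib sum_distrib_left\<close>)

lemma NS_form: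
  assumes "c \<in> NS A"
  shows "bilinear c" "c v w = - c w v" "c (cstruct A v) (cstruct A w) = c v w"
    "v \<in> periods A \<Longrightarrow> w \<in> periods A \<Longrightarrow> c v w \<in> \<int>"
  using assms unfolding NS_def by blast+

lemma NS_real_form:
  assumes "\<phi> \<in> NS_real A"
  shows "bilinear \<phi>" "\<phi> v w = - \<phi> w v" "\<phi> (cstruct A v) (cstruct A w) = \<phi> v w"
proof -
  obtain n r c where \<phi>: "\<phi> = (\<lambda>v w. \<Sum>i<(n::nat). r i * c i v w)"
    and c: "\<And>i. i < n \<Longrightarrow> c i \<in> NS A"
    using assms unfolding NS_real_def by blast
  show "bilinear \<phi>"
    unfolding \<phi> using c by (intro bilinear_sum_combination NS_form(1)) simp
  have "r i * c i v w = - (r i * c i w v)" if "i < n" for i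
    by (subst NS_form(2)[OF c[OF that]]) simp
  then show "\<phi> v w = - \<phi> w v"
    unfolding \<phi> sum_negf[symmetric] by (intro sum.cong refl) simp
  show "\<phi> (cstruct A v) (cstruct A w) = \<phi> v w"
    unfolding \<phi> using c by (intro sum.cong refl) (simp add: NS_form(3))
qed

lemma NS_real_uminus:
  assumes "\<phi> \<in> NS_real A"
  shows "(\<lambda>v w. - \<phi> v w) \<in> NS_real A"
proof -
  obtain n r c where \<phi>: "\<phi> = (\<lambda>v w. \<Sum>i<(n::nat). r i * c i v w)"
    and c: "\<forall>i<n. c i \<in> NS A"
    using assms unfolding NS_real_def by blast
  have "(\<lambda>v w. - \<phi> v w) = (\<lambda>v w. \<Sum>i<n. (- r i) * c i v w)"
    unfolding \<phi> by (simp add: sum_negf)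
  with c have "\<exists>n r c. (\<lambda>v w. - \<phi> v w) = (\<lambda>v w. \<Sum>i<(n::nat). r i * c i v w) \<and> (\<forall>i<n. c i \<in> NS A)"
    by (intro exI[of _ n] exI[of _ "\<lambda>i. - r i"] exI[of _ c] conjI)
  then show ?thesis
    unfolding NS_real_def mem_Collect_eq .
qed

lemma symmetric_form_bilinear:
  assumes "complex_torus A" "\<phi> \<in> NS_real A"
  shows "bilinear (symmetric_form A \<phi>)"
proof -
  have "linear (cstruct A)"
    using assms by (simp add: complex_torus_def)
  then show ?thesis
    unfolding bilinear_def symmetric_form_def
    using NS_real_form(1)[OF assms(2)]
    by (intro conjI allI linearI)
       (simp_all add: bilinear_ladd bilinear_radd bilinear_lmul bilinear_rmul linear_add linear_scale)
qed

lemma symmetric_form_commute: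
  assumes "complex_torus A" "\<phi> \<in> NS_real A"
  shows "symmetric_form A \<phi> v w = symmetric_form A \<phi> w v"
proof -
  have "\<phi> (cstruct A v) w = \<phi> (cstruct A (cstruct A v)) (cstruct A w)"
    using NS_real_form(3)[OF assms(2)] by simp
  also have "\<dots> = - \<phi> v (cstruct A w)"
    using assms(1) NS_real_form(1)[OF assms(2)] by (simp add: complex_torus_def bilinear_lneg)
  also have "\<dots> = \<phi> (cstruct A w) v"
    using NS_real_form(2)[OF assms(2), of v "cstruct A w"] by simp
  finally show ?thesis by (simp add: symmetric_form_def)
qed

lemma NS_subset_NS_real: "NS A \<subseteq> NS_real A"
proof
  fix c assume "c \<in> NS A"
  then show "c \<in> NS_real A"
    unfolding NS_real_def
    by (intro CollectI exI[of _ 1] exI[of _ "\<lambda>_. 1"] exI[of _ "\<lambda>_. c"]) simp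
qed

lemma NS_int_combination:
  assumes "\<And>i. i \<in> S \<Longrightarrow> c i \<in> NS A"
  shows "(\<lambda>v w. \<Sum>i\<in>S. of_int (z i) * c i v w) \<in> NS A"
  unfolding NS_def
proof (intro CollectI conjI allI ballI)
  show "bilinear (\<lambda>v w. \<Sum>i\<in>S. of_int (z i) * c i v w)"
    using assms by (intro bilinear_sum_combination NS_form(1)[where A = A]) simp
next
  fix v w
  show "(\<Sum>i\<in>S. of_int (z i) * c i v w) = - (\<Sum>i\<in>S. of_int (z i) * c i w v)"
    unfolding sum_negf[symmetric]
  proof (rule sum.cong[OF refl])
    fix i assume "i \<in> S"
    show "of_int (z i) * c i v w = - (of_int (z i) * c i w v)"
      by (subst NS_form(2)[OF assms[OF \<open>i \<in> S\<close>]]) simp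
  qed
next
  fix v w assume "v \<in> periods A" "w \<in> periods A"
  then show "(\<Sum>i\<in>S. of_int (z i) * c i v w) \<in> \<int>"
    using assms by (intro Ints_sum Ints_mult Ints_of_int NS_form(4)) auto
next
  fix v w
  show "(\<Sum>i\<in>S. of_int (z i) * c i (cstruct A v) (cstruct A w)) = (\<Sum>i\<in>S. of_int (z i) * c i v w)"
    using assms by (intro sum.cong refl) (simp add: NS_form(3))
qed

lemma NS_add_scaled:
  assumes "c \<in> NS A" "d \<in> NS A"
  shows "(\<lambda>v w. c v w + of_nat m * d v w) \<in> NS A"
proof -
  have "(\<lambda>v w. \<Sum>i\<in>(UNIV :: bool set). of_int (if i then 1 else int m) * (if i then c else d) v w) \<in> NS A"
    using assms by (intro NS_int_combination) auto
  then show ?thesis by (simp add: UNIV_bool add.commute)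
qed

text \<open>Write \<open>\<phi> = \<Sum> r\<^sub>i c\<^sub>i\<close> with \<open>c\<^sub>i\<close> integral, choose a large integer \<open>D\<close>, and split
  \<open>D r\<^sub>i = z\<^sub>i + e\<^sub>i\<close> into an integer and a remainder in \<open>(0, 1]\<close>. With \<open>H = \<Sum> z\<^sub>i c\<^sub>i\<close> integral,
  \<open>D \<phi> = \<Sum> e\<^sub>i/(n+1) \<cdot> (H + (n+1) c\<^sub>i) + (1 - E) H\<close> where \<open>E = \<Sum> e\<^sub>i/(n+1) < 1\<close>.
  All coefficients are positive. In terms of the quadratic forms of \<open>\<phi>(J\<cdot>, \<cdot>)\<close> and the like: if \<open>K \<phi>\<close>
  dominates each \<open>\<bar>c\<^sub>i\<bar>\<close>, then \<open>H\<close> dominates \<open>(D - nK) \<phi>\<close> because \<open>e\<^sub>i \<le> 1\<close>, so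
  \<open>D > nK + (n+1)K\<close> makes \<open>H\<close> and all \<open>H + (n+1) c\<^sub>i\<close> ample.\<close>

lemma positive_definite_in_ample_cone:
  fixes A :: "'a::real_vector torus"
  assumes A: "complex_torus A" and \<phi>: "\<phi> \<in> NS_real A"
    and pos: "positive_definite (symmetric_form A \<phi>)"
  shows "\<phi> \<in> ample_cone A"
proof -
  let ?h = "symmetric_form A"
  obtain n r c where \<phi>_eq: "\<phi> = (\<lambda>v w. \<Sum>i<(n::nat). r i * c i v w)"
    and c: "\<And>i. i < n \<Longrightarrow> c i \<in> NS A"
    using \<phi> unfolding NS_real_def by blast
  obtain B :: "'a set" where B: "finite B" "independent B" "span B = UNIV"
    by (rule finite_basis_of_complex_torus[OF A])
  have nonneg: "0 \<le> ?h \<phi> v v" for v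
    by (rule positive_definite_nonneg[OF pos symmetric_form_bilinear[OF A \<phi>]])
  have "\<exists>K\<ge>0. \<forall>v. \<bar>?h (c i) v v\<bar> \<le> K * ?h \<phi> v v" if "i < n" for i
  proof -
    have ci: "bilinear (?h (c i))"
      by (rule symmetric_form_bilinear[OF A subsetD[OF NS_subset_NS_real c[OF that]]])
    obtain K where "K \<ge> 0" "\<And>v. \<bar>?h (c i) v v\<bar> \<le> K * ?h \<phi> v v"
      using quadratic_form_dominated[OF B symmetric_form_bilinear[OF A \<phi>]
          symmetric_form_commute[OF A \<phi>] pos ci] by blast
    then show ?thesis by blast
  qed
  then have "\<forall>i. \<exists>K. i < n \<longrightarrow> K \<ge> 0 \<and> (\<forall>v. \<bar>?h (c i) v v\<bar> \<le> K * ?h \<phi> v v)"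
    by blast
  then obtain K' where "\<forall>i. i < n \<longrightarrow> K' i \<ge> 0 \<and> (\<forall>v. \<bar>?h (c i) v v\<bar> \<le> K' i * ?h \<phi> v v)"
    by (rule choice[THEN exE])
  then have K': "\<And>i. i < n \<Longrightarrow> K' i \<ge> 0"
    "\<And>i v. i < n \<Longrightarrow> \<bar>?h (c i) v v\<bar> \<le> K' i * ?h \<phi> v v"
    by blast+
  define K where "K = (\<Sum>i<n. K' i)"
  have K: "K \<ge> 0" "\<And>i v. i < n \<Longrightarrow> \<bar>?h (c i) v v\<bar> \<le> K * ?h \<phi> v v"
  proof -
    show "K \<ge> 0" unfolding K_def using K'(1) by (intro sum_nonneg) auto
    fix i v assume i: "i < n"
    then have "K' i \<le> K"
      unfolding K_def using K'(1) by (intro member_le_sum) auto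
    then show "\<bar>?h (c i) v v\<bar> \<le> K * ?h \<phi> v v"
      using K'(2)[OF i, of v] nonneg[of v] by (meson mult_right_mono order_trans)
  qed
  define D where "D = nat \<lceil>(2 * real n + 1) * K\<rceil> + 1"
  have D: "real D > (2 * real n + 1) * K"
    unfolding D_def by linarith
  \<comment> \<open>ceiling minus one, not floor: the remainders must not vanish, since the coefficients of a
    cone element are strictly positive\<close>
  define z where "z i = \<lceil>real D * r i\<rceil> - 1" for i
  define e where "e i = real D * r i - of_int (z i)" for i
  have e: "0 < e i" "e i \<le> 1" for i
    unfolding e_def z_def by linarith+
  define H where "H = (\<lambda>v w. \<Sum>i<n. of_int (z i) * c i v w)"
  have H_eq: "H v w = real D * \<phi> v w - (\<Sum>i<n. e i * c i v w)" for v w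
    unfolding H_def \<phi>_eq e_def by (simp add: sum_distrib_left sum_subtractf algebra_simps)
  have H_lower: "(real D - real n * K) * ?h \<phi> v v \<le> ?h H v v" for v
  proof -
    have "(\<Sum>i<n. e i * ?h (c i) v v) \<le> (\<Sum>i<n. K * ?h \<phi> v v)"
    proof (rule sum_mono)
      fix i assume "i \<in> {..<n}"
      then have bd: "\<bar>?h (c i) v v\<bar> \<le> K * ?h \<phi> v v" using K(2) by simp
      have "e i * ?h (c i) v v \<le> \<bar>e i * ?h (c i) v v\<bar>" by simp
      also have "\<dots> \<le> 1 * \<bar>?h (c i) v v\<bar>"
        unfolding abs_mult using e[of i] by (intro mult_right_mono) auto
      finally show "e i * ?h (c i) v v \<le> K * ?h \<phi> v v" using bd by linarith
    qed
    then show ?thesis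
      unfolding symmetric_form_def H_eq by (simp add: algebra_simps)
  qed
  define d where "d i = (\<lambda>v w. H v w + of_nat (n + 1) * c i v w)" for i
  have H_NS: "H \<in> NS A"
    unfolding H_def using c by (intro NS_int_combination) auto
  have H_ample: "H \<in> ample_classes A"
  proof -
    have "0 < H (cstruct A v) v" if "v \<noteq> 0" for v
    proof -
      have "0 < ?h \<phi> v v" using pos that by (simp add: positive_definite_def)
      moreover have "real D - real n * K > 0"
        using D K(1) mult_nonneg_nonneg[of "real n" K] by (simp add: algebra_simps)
      ultimately have "0 < (real D - real n * K) * ?h \<phi> v v" by simp
      then show ?thesis using H_lower[of v] by (simp add: symmetric_form_def)
    qed
    with H_NS show ?thesis by (simp add: ample_classes_def)
  qed
  have d_ample: "d i \<in> ample_classes A" if i: "i < n" for i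
  proof -
    have "d i \<in> NS A"
      unfolding d_def by (rule NS_add_scaled[OF H_NS c[OF i]])
    moreover have "0 < d i (cstruct A v) v" if "v \<noteq> 0" for v
    proof -
      have "0 < ?h \<phi> v v" using pos that by (simp add: positive_definite_def)
      then have "0 < (real D - (2 * real n + 1) * K) * ?h \<phi> v v" using D by simp
      also have "\<dots> = (real D - real n * K) * ?h \<phi> v v - real (n + 1) * (K * ?h \<phi> v v)"
        by (simp add: algebra_simps)
      also have "\<dots> \<le> ?h H v v + real (n + 1) * ?h (c i) v v"
      proof -
        have "- (K * ?h \<phi> v v) \<le> ?h (c i) v v" using K(2)[OF i, of v] by linarith
        then have "real (n + 1) * - (K * ?h \<phi> v v) \<le> real (n + 1) * ?h (c i) v v"
          by (intro mult_left_mono) auto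
        with H_lower[of v] show ?thesis by linarith
      qed
      finally show ?thesis by (simp add: d_def symmetric_form_def)
    qed
    ultimately show ?thesis by (simp add: ample_classes_def)
  qed
  define E where "E = (\<Sum>i<n. e i) / real (n + 1)"
  have E: "E < 1"
  proof -
    have "(\<Sum>i<n. e i) \<le> (\<Sum>i<n. 1)" by (intro sum_mono e)
    then show ?thesis by (simp add: E_def)
  qed
  have D0: "real D > 0" unfolding D_def by simp
  \<comment> \<open>the \<open>n\<close> classes \<open>d i\<close>, followed by \<open>H\<close> at index \<open>n\<close>\<close>
  define s where "s i = (if i < n then e i / real (n + 1) else 1 - E) / real D" for i
  define k where "k i = (if i < n then d i else H)" for i
  have "\<phi> v w = (\<Sum>i<Suc n. s i * k i v w)" for v w
  proof -
    have "(\<Sum>i<n. s i * k i v w) = (\<Sum>i<n. (e i / real (n + 1) * H v w + e i * c i v w) / real D)"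
      by (intro sum.cong refl) (simp add: s_def k_def d_def field_simps)
    also have "\<dots> = (E * H v w + (\<Sum>i<n. e i * c i v w)) / real D"
      by (simp add: E_def sum_divide_distrib[symmetric] sum.distrib sum_distrib_right[symmetric])
    finally have "(\<Sum>i<Suc n. s i * k i v w) = (H v w + (\<Sum>i<n. e i * c i v w)) / real D"
      using D0 by (simp add: s_def k_def field_simps)
    also have "\<dots> = \<phi> v w"
      unfolding H_eq using D0 by simp
    finally show ?thesis by simp
  qed
  moreover have "s i > 0" for i
    unfolding s_def using e(1)[of i] E D0 by simp
  moreover have "k i \<in> ample_classes A" for i
    unfolding k_def using H_ample d_ample by simp
  ultimately show ?thesis
    unfolding ample_cone_def
    by (intro CollectI exI[of _ "Suc n"] exI[of _ s] exI[of _ k]) (auto simp: fun_eq_iff)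
qed

lemma ample_cone_positive_definite:
  assumes "\<phi> \<in> ample_cone A"
  shows "positive_definite (symmetric_form A \<phi>)"
proof -
  obtain n r c where \<phi>: "\<phi> = (\<lambda>v w. \<Sum>i<(n::nat). r i * c i v w)" and n: "n > 0"
    and c: "\<And>i. i < n \<Longrightarrow> r i > 0 \<and> c i \<in> ample_classes A"
    using assms unfolding ample_cone_def by blast
  show ?thesis
    unfolding positive_definite_def symmetric_form_def \<phi>
    using c n by (intro allI impI sum_pos) (auto simp: ample_classes_def)
qed

lemma ample_cone_nonempty_imp_abelian_variety:
  assumes "complex_torus A" "\<phi> \<in> ample_cone A"
  shows "abelian_variety A"
proof -
  obtain n and c :: "nat \<Rightarrow> 'a form" where "n > 0" "\<forall>i<n. c i \<in> ample_classes A"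
    using assms(2) unfolding ample_cone_def by blast
  with assms(1) show ?thesis
    unfolding abelian_variety_def by blast
qed

lemma complexified_cone_negI:
  assumes "\<phi>\<^sub>1 \<in> NS_real A" "\<phi>\<^sub>2 \<in> ample_cone A"
  shows "complex_form \<phi>\<^sub>1 (\<lambda>v w. - \<phi>\<^sub>2 v w) \<in> complexified_cone A"
  using assms by (auto simp: complexified_cone_def)

section \<open>The form \<open>Q(IJ\<cdot>, \<cdot>)\<close> of a weak pair\<close>

locale torus_with_weak_form =
  fixes A :: "'a::real_vector torus" and \<omega> :: "'a \<Rightarrow> 'a \<Rightarrow> complex"
  assumes weak_pair: "weak_pair A \<omega>"
begin

abbreviation "\<phi>\<^sub>1 \<equiv> re_form \<omega>"
abbreviation "\<phi>\<^sub>2 \<equiv> im_form \<omega>"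
abbreviation "J \<equiv> cstruct A"

text \<open>The identification \<open>V \<oplus> V\<^sup>* \<cong> V \<otimes> \<complex>\<close>, under which \<open>I\<^sub>\<omega>\<close> is multiplication by
  \<open>-i\<close> on \<open>v + iu\<close>: the second coordinate is the \<open>u\<close> with \<open>I\<^sub>\<omega>(v, l) = (u, \<dots>)\<close>.\<close>

definition chart :: "'a \<times> 'a \<Rightarrow> 'a \<times> 'a dual" where
  "chart = (\<lambda>(v, u). (v, form_map \<phi>\<^sub>1 v - form_map \<phi>\<^sub>2 u))"

lemma torus: "complex_torus A"
  using weak_pair by (simp add: weak_pair_def)

lemma J: "linear J" "J (J v) = - v"
  using torus by (auto simp: complex_torus_def)

lemma parts: "\<phi>\<^sub>1 \<in> NS_real A" "\<phi>\<^sub>2 \<in> NS_real A" "nondegenerate \<phi>\<^sub>2"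
  and \<omega>_eq: "\<omega> = complex_form \<phi>\<^sub>1 \<phi>\<^sub>2"
  using weak_pair
  by (auto simp: weak_pair_def NS_complex0_def NS_real0_def re_form_def im_form_def complex_form_def)

lemmas bil = NS_real_form(1)[OF parts(1)] NS_real_form(1)[OF parts(2)]

lemma bij_\<phi>\<^sub>2: "bij (form_map \<phi>\<^sub>2)"
  by (rule finite_basis_of_complex_torus[OF torus]) (rule bij_form_map[OF _ _ _ bil(2) parts(3)])

lemma surj_chart: "surj chart"
proof (rule surjI)
  fix y
  show "chart (fst y, inv (form_map \<phi>\<^sub>2) (form_map \<phi>\<^sub>1 (fst y) - snd y)) = y"
    by (simp add: chart_def surj_f_inv_f[OF bij_is_surj[OF bij_\<phi>\<^sub>2]])
qed

lemma I_op_chart: "I_op \<omega> (chart (v, u)) = chart (u, - v)"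
proof -
  let ?f = "form_map \<phi>\<^sub>2" and ?f1 = "form_map \<phi>\<^sub>1"
  have lin: "linear ?f" "linear ?f1"
    using bil by (simp_all add: linear_form_map)
  have inv_diff: "inv ?f (a - b) = inv ?f a - inv ?f b" for a b
  proof (rule injD[OF bij_is_inj[OF bij_\<phi>\<^sub>2]])
    show "?f (inv ?f (a - b)) = ?f (inv ?f a - inv ?f b)"
      using bij_\<phi>\<^sub>2 by (simp add: linear_diff[OF lin(1)] surj_f_inv_f bij_is_surj)
  qed
  have inv: "inv ?f (?f x) = x" for x
    using bij_\<phi>\<^sub>2 by (simp add: bij_is_inj)
  show ?thesis
    by (simp add: I_op_def Let_def chart_def inv_diff inv linear_diff[OF lin(2)]
        linear_neg[OF lin(1)])
qed

lemma dual_J_form_map: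
  assumes "\<phi> \<in> NS_real A"
  shows "cstruct (dual_torus A) (form_map \<phi> v) = form_map \<phi> (J v)"
proof (rule dual_eqI)
  fix w
  have "\<phi> v (- J w) = - \<phi> (J v) (J (J w))"
    using NS_real_form(1,3)[OF assms] by (simp add: bilinear_rneg)
  then show "app (cstruct (dual_torus A) (form_map \<phi> v)) w = app (form_map \<phi> (J v)) w"
    using NS_real_form(1)[OF assms]
    by (simp add: app_cstruct_dual_torus[OF J(1)] J(2) bilinear_rneg)
qed

lemma J_prod_chart: "J_prod A (chart (v, u)) = chart (J v, J u)"
proof -
  have "cstruct (dual_torus A) (a - b) = cstruct (dual_torus A) a - cstruct (dual_torus A) b" for a b
    by (rule dual_eqI) (simp add: app_cstruct_dual_torus[OF J(1)])
  then show ?thesis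
    using parts by (simp add: J_prod_def chart_def dual_J_form_map)
qed

lemma Q_chart: "Q (chart (v, u)) (chart (v', u')) = - \<phi>\<^sub>2 u v' - \<phi>\<^sub>2 u' v"
  using bil NS_real_form(2)[OF parts(1), of v v'] by (simp add: Q_def chart_def)

lemma I_J_commute: "I_op \<omega> (J_prod A x) = J_prod A (I_op \<omega> x)"
proof -
  obtain v u where x: "x = chart (v, u)" using surj_chart by (metis surjD surj_pair)
  show ?thesis
    by (simp add: x J_prod_chart I_op_chart linear_neg[OF J(1)])
qed

lemma Q_IJ_chart:
  "Q (I_op \<omega> (J_prod A (chart (v, u)))) (chart (v, u))
     = symmetric_form A \<phi>\<^sub>2 v v + symmetric_form A \<phi>\<^sub>2 u u"
  using NS_real_form(2)[OF parts(2), of u "J u"] bilinear_lneg[OF bil(2), of "J v" v]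
  by (simp add: J_prod_chart I_op_chart Q_chart symmetric_form_def)

text \<open>The sign \<open>s\<close> lets one statement treat both components of the complexified cone.\<close>

lemma positive_definite_iff_Q_IJ:
  "positive_definite (symmetric_form A (\<lambda>v w. s * \<phi>\<^sub>2 v w)) \<longleftrightarrow>
     (\<forall>x. x \<noteq> 0 \<longrightarrow> 0 < s * Q (I_op \<omega> (J_prod A x)) x)"
proof
  assume pos: "positive_definite (symmetric_form A (\<lambda>v w. s * \<phi>\<^sub>2 v w))"
  show "\<forall>x. x \<noteq> 0 \<longrightarrow> 0 < s * Q (I_op \<omega> (J_prod A x)) x"
  proof (intro allI impI)
    fix x :: "'a \<times> 'a dual" assume "x \<noteq> 0"
    obtain v u where x: "x = chart (v, u)" using surj_chart by (metis surjD surj_pair)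
    have lin: "linear (form_map \<phi>\<^sub>1)" "linear (form_map \<phi>\<^sub>2)"
      using bil by (simp_all add: linear_form_map)
    have "v \<noteq> 0 \<or> u \<noteq> 0"
      using \<open>x \<noteq> 0\<close> by (auto simp: x chart_def zero_prod_def linear_0[OF lin(1)] linear_0[OF lin(2)])
    moreover have strict: "0 < s * symmetric_form A \<phi>\<^sub>2 w w" if "w \<noteq> 0" for w
      using pos that by (simp add: positive_definite_def symmetric_form_def)
    moreover have "0 \<le> s * symmetric_form A \<phi>\<^sub>2 w w" for w
    proof (cases "w = 0")
      case True
      then show ?thesis
        using bil(2) by (simp add: symmetric_form_def bilinear_rzero)
    next
      case False
      then show ?thesis using strict by (simp add: less_imp_le)
    qed
    ultimately have "0 < s * symmetric_form A \<phi>\<^sub>2 v v + s * symmetric_form A \<phi>\<^sub>2 u u"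
      by (meson add_nonneg_pos add_pos_nonneg)
    then show "0 < s * Q (I_op \<omega> (J_prod A x)) x"
      unfolding x Q_IJ_chart by (simp add: distrib_left)
  qed
next
  assume pos: "\<forall>x. x \<noteq> 0 \<longrightarrow> 0 < s * Q (I_op \<omega> (J_prod A x)) x"
  show "positive_definite (symmetric_form A (\<lambda>v w. s * \<phi>\<^sub>2 v w))"
    unfolding positive_definite_def
  proof (intro allI impI)
    fix v :: 'a assume "v \<noteq> 0"
    then have "chart (v, 0) \<noteq> 0" by (simp add: chart_def prod_eq_iff)
    with pos have "0 < s * Q (I_op \<omega> (J_prod A (chart (v, 0)))) (chart (v, 0))" by blast
    then show "0 < symmetric_form A (\<lambda>v w. s * \<phi>\<^sub>2 v w) v v"
      using bil(2) unfolding Q_IJ_chart by (simp add: symmetric_form_def bilinear_rzero)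
  qed
qed

lemma complexified_cone_iff:
  "\<omega> \<in> complexified_cone A \<longleftrightarrow>
     (\<exists>s\<in>{1, -1}. positive_definite (symmetric_form A (\<lambda>v w. s * \<phi>\<^sub>2 v w)))"
proof
  assume "\<omega> \<in> complexified_cone A"
  then obtain \<psi> where \<psi>: "\<psi> \<in> ample_cone A" and "\<phi>\<^sub>2 = \<psi> \<or> \<phi>\<^sub>2 = (\<lambda>v w. - \<psi> v w)"
    by (auto simp: complexified_cone_def complex_form_def im_form_def)
  then have "\<psi> = (\<lambda>v w. 1 * \<phi>\<^sub>2 v w) \<or> \<psi> = (\<lambda>v w. - 1 * \<phi>\<^sub>2 v w)"
    by (auto simp: fun_eq_iff)
  with ample_cone_positive_definite[OF \<psi>]
  show "\<exists>s\<in>{1, -1}. positive_definite (symmetric_form A (\<lambda>v w. s * \<phi>\<^sub>2 v w))"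
    by blast
next
  assume "\<exists>s\<in>{1, -1}. positive_definite (symmetric_form A (\<lambda>v w. s * \<phi>\<^sub>2 v w))"
  then consider "positive_definite (symmetric_form A \<phi>\<^sub>2)"
    | "positive_definite (symmetric_form A (\<lambda>v w. - \<phi>\<^sub>2 v w))"
    by auto
  then show "\<omega> \<in> complexified_cone A"
  proof cases
    case 1
    then have "\<phi>\<^sub>2 \<in> ample_cone A"
      using positive_definite_in_ample_cone[OF torus parts(2)] by simp
    with parts(1) \<omega>_eq show ?thesis
      unfolding complexified_cone_def by blast
  next
    case 2
    then have "(\<lambda>v w. - \<phi>\<^sub>2 v w) \<in> ample_cone A"
      using positive_definite_in_ample_cone[OF torus NS_real_uminus[OF parts(2)]] by simp
    with parts(1) have "complex_form \<phi>\<^sub>1 (\<lambda>v w. - (- \<phi>\<^sub>2 v w)) \<in> complexified_cone A"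
      by (rule complexified_cone_negI)
    then show ?thesis by (simp flip: \<omega>_eq)
  qed
qed

text \<open>The right-hand side depends on \<open>Q\<close>, \<open>I\<close> and \<open>J\<close> alone, which is why it can be transported along a
  mirror isomorphism.\<close>

lemma algebraic_pair_iff:
  "algebraic_pair A \<omega> \<longleftrightarrow>
     (\<exists>s\<in>{1, -1}. \<forall>x. x \<noteq> 0 \<longrightarrow> 0 < s * Q (I_op \<omega> (J_prod A x)) x)"
proof -
  have "abelian_variety A" if "\<omega> \<in> complexified_cone A"
    using that ample_cone_nonempty_imp_abelian_variety[OF torus]
    by (auto simp: complexified_cone_def)
  then have "algebraic_pair A \<omega> \<longleftrightarrow> \<omega> \<in> complexified_cone A"
    using weak_pair unfolding algebraic_pair_def by blast
  then show ?thesis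
    unfolding complexified_cone_iff positive_definite_iff_Q_IJ .
qed

end

section \<open>Transport along a mirror isomorphism\<close>

lemma bilinear_Q: "bilinear Q"
  unfolding bilinear_def
  by (intro conjI allI linearI)
     (simp_all add: Q_def linear_add[OF linear_app] linear_scale[OF linear_app] algebra_simps)

text \<open>Passing from \<open>\<Lambda>\<^sub>A\<close> to \<open>V \<oplus> V\<^sup>*\<close> is necessary, as \<open>I\<close> and \<open>J\<close> do not preserve the lattices
  in general.\<close>

lemma lattice_isometry_extends:
  assumes A: "complex_torus A" and B: "complex_torus B"
    and \<alpha>: "linear \<alpha>" "bij_betw \<alpha> (Lambda A) (Lambda B)"
    and Q: "\<forall>x\<in>Lambda A. \<forall>y\<in>Lambda A. Q (\<alpha> x) (\<alpha> y) = Q x y"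
  shows "surj \<alpha>" "Q (\<alpha> x) (\<alpha> y) = Q x y"
proof -
  have "range \<alpha> = \<alpha> ` span (Lambda A)"
    using span_Lambda[OF A] by simp
  also have "\<dots> = span (\<alpha> ` Lambda A)"
    using linear_span_image[OF \<alpha>(1)] by metis
  also have "\<dots> = UNIV"
    using \<alpha>(2) span_Lambda[OF B] by (simp add: bij_betw_imp_surj_on)
  finally show "surj \<alpha>" .
  have "bilinear (\<lambda>x y. Q (\<alpha> x) (\<alpha> y))"
    unfolding bilinear_def
    by (intro conjI allI linearI)
       (simp_all add: linear_add[OF \<alpha>(1)] linear_scale[OF \<alpha>(1)] bilinear_ladd[OF bilinear_Q]
         bilinear_radd[OF bilinear_Q] bilinear_lmul[OF bilinear_Q] bilinear_rmul[OF bilinear_Q])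
  then show "Q (\<alpha> x) (\<alpha> y) = Q x y"
    by (rule bilinear_eq[OF _ bilinear_Q, where S = UNIV and T = UNIV])
       (use Q span_Lambda[OF A] in auto)
qed

theorem proposition9p4p3:
  fixes A :: "'a::real_vector torus" and \<omega>A :: "'a \<Rightarrow> 'a \<Rightarrow> complex"
    and B :: "'b::real_vector torus" and \<omega>B :: "'b \<Rightarrow> 'b \<Rightarrow> complex"
  assumes "weak_pair A \<omega>A" and "weak_pair B \<omega>B"
    and "mirror_symmetric A \<omega>A B \<omega>B"
    and "algebraic_pair A \<omega>A"
  shows "algebraic_pair B \<omega>B"
proof -
  interpret A: torus_with_weak_form A \<omega>A by standard (fact assms(1))
  interpret B: torus_with_weak_form B \<omega>B by standard (fact assms(2))
  obtain \<alpha> where \<alpha>: "linear \<alpha>" "bij_betw \<alpha> (Lambda A) (Lambda B)"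
    and Q_lattice: "\<forall>x\<in>Lambda A. \<forall>y\<in>Lambda A. Q (\<alpha> x) (\<alpha> y) = Q x y"
    and JI: "\<alpha> \<circ> J_prod A = I_op \<omega>B \<circ> \<alpha>" and IJ: "\<alpha> \<circ> I_op \<omega>A = J_prod B \<circ> \<alpha>"
    using assms(3) unfolding mirror_symmetric_def by blast
  note iso = lattice_isometry_extends[OF A.torus B.torus \<alpha> Q_lattice]
  obtain s where s: "s \<in> {1, -1}"
    and IJ_definite: "\<forall>x. x \<noteq> 0 \<longrightarrow> 0 < s * Q (I_op \<omega>A (J_prod A x)) x"
    using assms(4) unfolding A.algebraic_pair_iff by (rule bexE)
  have "0 < s * Q (I_op \<omega>B (J_prod B y)) y" if "y \<noteq> 0" for y
  proof -
    obtain x where y: "y = \<alpha> x" using iso(1) by (meson surjD)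
    with that have "x \<noteq> 0" using linear_0[OF \<alpha>(1)] by auto
    \<comment> \<open>\<open>\<alpha>\<close> exchanges \<open>I\<close> and \<open>J\<close>, so \<open>I J\<close> becomes \<open>J I\<close>; commutativity restores the order\<close>
    have "\<alpha> (I_op \<omega>A (J_prod A x)) = J_prod B (\<alpha> (J_prod A x))"
      using fun_cong[OF IJ, of "J_prod A x"] by simp
    also have "\<dots> = J_prod B (I_op \<omega>B (\<alpha> x))"
      using fun_cong[OF JI, of x] by simp
    also have "\<dots> = I_op \<omega>B (J_prod B y)"
      by (simp add: y B.I_J_commute)
    finally have "Q (I_op \<omega>B (J_prod B y)) y = Q (I_op \<omega>A (J_prod A x)) x"
      using iso(2)[of "I_op \<omega>A (J_prod A x)" x] y by simp
    with IJ_definite[rule_format, OF \<open>x \<noteq> 0\<close>] show ?thesis by (simp only:)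
  qed
  then show ?thesis
    unfolding B.algebraic_pair_iff by (intro bexI[OF _ s] allI impI)
qed

end
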